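(* Let $(X,\Delta)$ be a complete $b$-suprametric space with $X$ nonempty (with constants $s\ge 1$ and $c\ge 0$), let $\theta:[0,\infty)\to[0,\infty)$ belong to $\Theta_1$, and let $T:X\to X$ be a mapping such that: (i) for all $x,y\in X$, $\Delta(Tx,Ty)\le \theta\big(\max\{\Delta(x,y),\Delta(x,Tx),\Delta(y,Ty)\}\big)$; (ii) either $T$ is continuous, or $\Delta$ is continuous in each variable (separately continuous); (iii) $T$ has bounded orbits. Then there is a point $\xi\in X$ such that: (a) for every $x\in X$ the sequence $\{T^n x\}_{n=1}^\infty$ converges to $\xi$; and (b) $\xi$ is the unique fixed point of $T$ in $X$.
   Context: A semi-metric on a set $X$ is a function $\Delta:X\times X\to[0,\infty)$ with $\Delta(x,y)=0$ if and only if $x=y$, and $\Delta(x,y)=\Delta(y,x)$ for all $x,y\in X$. A semi-metric $\Delta$ is a $b$-suprametric if there exist constants $s\ge1$, $c\ge0$ such that for all $x,y,z\in X$, $\Delta(x,y)\le s(\Delta(x,z)+\Delta(z,y))+c\,\Delta(x,z)\Delta(z,y)$; then $(X,\Delta)$ is called a $b$-suprametric space. A sequence $\{x_n\}$ converges to $a\in X$ if $\Delta(x_n,a)\to0$. It is Cauchy if for every $\epsilon>0$ there is $m_0\in\mathbb N$ with $\Delta(x_n,x_m)<\epsilon$ for all $n,m>m_0$. $(X,\Delta)$ is complete if every Cauchy sequence converges to a point of $X$. A subset $Y\subset X$ is bounded if there is $M>0$ with $\Delta(x,y)\le M$ for all $x,y\in Y$. $T$ is continuous if $x_n\to x$ implies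 $Tx_n\to Tx$. $\Delta$ is separately continuous (continuous in each variable) if $\Delta(y_n,y)\to0$ implies $\Delta(x,y_n)\to\Delta(x,y)$ for all $x,y\in X$ and all sequences $(y_n)$ in $X$. The orbit of $x\in X$ under $T$ is the sequence $\{T^nx\}_{n=0}^\infty$, with $T^0x=x$, $T^{n+1}x=T(T^nx)$. $T$ has bounded orbits if for every $x\in X$ the set $\{T^nx: n\ge0\}$ is bounded. $\Theta_1$ is the set of non-decreasing functions $\theta:[0,\infty)\to[0,\infty)$ such that $\theta^n(t)\to0$ as $n\to\infty$ for each $t>0$, where $\theta^n$ is the $n$-fold iterate. *)

theory Defs
  imports Complex_Main "HOL-Library.FuncSet"
begin

text \<open>Spaces are given by an explicit carrier \<open>X\<close>; the values of \<open>\<Delta>\<close> outside \<open>X \<times> X\<close> are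
  irrelevant throughout.\<close>

definition semi_metric :: "'a set \<Rightarrow> ('a \<Rightarrow> 'a \<Rightarrow> real) \<Rightarrow> bool" where
  "semi_metric X \<Delta> \<longleftrightarrow>
     (\<forall>x\<in>X. \<forall>y\<in>X. 0 \<le> \<Delta> x y) \<and>
     (\<forall>x\<in>X. \<forall>y\<in>X. \<Delta> x y = 0 \<longleftrightarrow> x = y) \<and>
     (\<forall>x\<in>X. \<forall>y\<in>X. \<Delta> x y = \<Delta> y x)"

definition b_suprametric :: "'a set \<Rightarrow> ('a \<Rightarrow> 'a \<Rightarrow> real) \<Rightarrow> bool" where
  "b_suprametric X \<Delta> \<longleftrightarrow>
     semi_metric X \<Delta> \<and>
     (\<exists>s\<ge>1. \<exists>c\<ge>0. \<forall>x\<in>X. \<forall>y\<in>X. \<forall>z\<in>X.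
        \<Delta> x y \<le> s * (\<Delta> x z + \<Delta> z y) + c * \<Delta> x z * \<Delta> z y)"

definition sm_converges :: "'a set \<Rightarrow> ('a \<Rightarrow> 'a \<Rightarrow> real) \<Rightarrow> (nat \<Rightarrow> 'a) \<Rightarrow> 'a \<Rightarrow> bool" where
  "sm_converges X \<Delta> u a \<longleftrightarrow> range u \<subseteq> X \<and> a \<in> X \<and> (\<lambda>n. \<Delta> (u n) a) \<longlonglongrightarrow> 0"

definition sm_Cauchy :: "'a set \<Rightarrow> ('a \<Rightarrow> 'a \<Rightarrow> real) \<Rightarrow> (nat \<Rightarrow> 'a) \<Rightarrow> bool" where
  "sm_Cauchy X \<Delta> u \<longleftrightarrow>
     range u \<subseteq> X \<and> (\<forall>\<epsilon>>0. \<exists>m0. \<forall>n>m0. \<forall>m>m0. \<Delta> (u n) (u m) < \<epsilon>)"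

definition sm_complete :: "'a set \<Rightarrow> ('a \<Rightarrow> 'a \<Rightarrow> real) \<Rightarrow> bool" where
  "sm_complete X \<Delta> \<longleftrightarrow> (\<forall>u. sm_Cauchy X \<Delta> u \<longrightarrow> (\<exists>a\<in>X. sm_converges X \<Delta> u a))"

definition sm_bounded :: "'a set \<Rightarrow> ('a \<Rightarrow> 'a \<Rightarrow> real) \<Rightarrow> 'a set \<Rightarrow> bool" where
  "sm_bounded X \<Delta> Y \<longleftrightarrow> Y \<subseteq> X \<and> (\<exists>M>0. \<forall>x\<in>Y. \<forall>y\<in>Y. \<Delta> x y \<le> M)"

definition sm_continuous_map :: "'a set \<Rightarrow> ('a \<Rightarrow> 'a \<Rightarrow> real) \<Rightarrow> ('a \<Rightarrow> 'a) \<Rightarrow> bool" where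
  "sm_continuous_map X \<Delta> T \<longleftrightarrow>
     (\<forall>u x. sm_converges X \<Delta> u x \<longrightarrow> sm_converges X \<Delta> (\<lambda>n. T (u n)) (T x))"

definition separately_continuous :: "'a set \<Rightarrow> ('a \<Rightarrow> 'a \<Rightarrow> real) \<Rightarrow> bool" where
  "separately_continuous X \<Delta> \<longleftrightarrow>
     (\<forall>x\<in>X. \<forall>u y. sm_converges X \<Delta> u y \<longrightarrow> (\<lambda>n. \<Delta> x (u n)) \<longlonglongrightarrow> \<Delta> x y)"

definition bounded_orbits :: "'a set \<Rightarrow> ('a \<Rightarrow> 'a \<Rightarrow> real) \<Rightarrow> ('a \<Rightarrow> 'a) \<Rightarrow> bool" where
  "bounded_orbits X \<Delta> T \<longleftrightarrow> (\<forall>x\<in>X. sm_bounded X \<Delta> (range (\<lambda>n. (T ^^ n) x)))"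

text \<open>Functions \<open>[0,\<infinity>) \<rightarrow> [0,\<infinity>)\<close> are real functions mapping \<open>{0..}\<close> into itself; their values on
  negative arguments are unconstrained.\<close>

definition Theta1 :: "(real \<Rightarrow> real) set" where
  "Theta1 = {\<theta>. \<theta> \<in> {0..} \<rightarrow> {0..} \<and> mono_on {0..} \<theta> \<and>
                 (\<forall>t>0. (\<lambda>n. (\<theta> ^^ n) t) \<longlonglongrightarrow> 0)}"

end

theory Submission
  imports Defs
begin

text \<open>If \<open>M\<close> bounds the orbit of \<open>x\<close>, then each application of \<open>T\<close> improves the bound by one
  application of \<open>\<theta>\<close>, since the maximum in the contraction condition only involves distances
  between orbit points: the tail from index \<open>k\<close> on has diameter at most \<open>(\<theta> ^^ k) M\<close>. So orbits are
  Cauchy. If the limit \<open>\<xi>\<close> had \<open>d = \<Delta> \<xi> (T \<xi>) > 0\<close>, then under separate continuity the maximum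
  is eventually \<open>d\<close> and passing to the limit gives \<open>d \<le> \<theta> d\<close>, which no member of \<open>Theta1\<close>
  admits. The same fact yields uniqueness.\<close>

text \<open>Monotonicity carries \<open>d \<le> \<theta> d\<close> up to
  \<open>d \<le> (\<theta> ^^ n) d\<close> for every \<open>n\<close>, while a positive
  \<open>d\<close> would have iterates tending to 0.\<close>

lemma Theta1_no_subfixed_point:
  assumes "\<theta> \<in> Theta1" and "0 \<le> d" and "d \<le> \<theta> d"
  shows "d = 0"
proof (rule ccontr)
  assume "d \<noteq> 0"
  with assms have lim: "(\<lambda>n. (\<theta> ^^ n) d) \<longlonglongrightarrow> 0"
    by (auto simp: Theta1_def)
  have "d \<le> (\<theta> ^^ n) d" for n
  proof (induction n)
    case (Suc n)
    with assms have "\<theta> d \<le> \<theta> ((\<theta> ^^ n) d)"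
      by (auto simp: Theta1_def intro: mono_onD)
    with assms(3) show ?case by simp
  qed simp
  then have "d \<le> 0"
    using lim by (intro LIMSEQ_le_const) auto
  with \<open>d \<noteq> 0\<close> assms(2) show False by simp
qed

text \<open>With \<open>u n\<close> as the middle point, the relaxed triangle inequality bounds
  \<open>\<Delta> a b\<close> by a polynomial without constant term in two null sequences. It
  identifies the two limits of the shifted orbit when \<open>T\<close> is continuous.\<close>

lemma b_suprametric_limit_unique:
  assumes "b_suprametric X \<Delta>" and "sm_converges X \<Delta> u a" and "sm_converges X \<Delta> u b"
  shows "a = b"
proof -
  have X: "a \<in> X" "b \<in> X" "\<And>n. u n \<in> X"
    and lim: "(\<lambda>n. \<Delta> (u n) a) \<longlonglongrightarrow> 0" "(\<lambda>n. \<Delta> (u n) b) \<longlonglongrightarrow> 0"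
    using assms by (auto simp: sm_converges_def)
  have sm: "semi_metric X \<Delta>"
    using assms(1) by (simp add: b_suprametric_def)
  obtain s c where tri: "\<And>x y z. x \<in> X \<Longrightarrow> y \<in> X \<Longrightarrow> z \<in> X \<Longrightarrow>
      \<Delta> x y \<le> s * (\<Delta> x z + \<Delta> z y) + c * \<Delta> x z * \<Delta> z y"
    using assms(1) unfolding b_suprametric_def by blast
  have "\<Delta> a b \<le> s * (\<Delta> (u n) a + \<Delta> (u n) b) + c * \<Delta> (u n) a * \<Delta> (u n) b" for n
  proof -
    have "\<Delta> a (u n) = \<Delta> (u n) a"
      using sm X by (simp add: semi_metric_def)
    with tri[OF X(1,2) X(3)[of n]] show ?thesis by simp
  qed
  moreover have "(\<lambda>n. s * (\<Delta> (u n) a + \<Delta> (u n) b) + c * \<Delta> (u n) a * \<Delta> (u n) b)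
      \<longlonglongrightarrow> s * (0 + 0) + c * 0 * 0"
    by (intro tendsto_intros lim)
  ultimately have "\<Delta> a b \<le> 0"
    by (intro LIMSEQ_le_const) auto
  moreover have "0 \<le> \<Delta> a b" "\<Delta> a b = 0 \<longleftrightarrow> a = b"
    using sm X by (auto simp: semi_metric_def)
  ultimately show ?thesis by simp
qed

locale b_suprametric_contraction =
  fixes X :: "'a set" and \<Delta> :: "'a \<Rightarrow> 'a \<Rightarrow> real"
    and \<theta> :: "real \<Rightarrow> real" and T :: "'a \<Rightarrow> 'a"
  assumes bsm: "b_suprametric X \<Delta>" and Theta1: "\<theta> \<in> Theta1" and T: "T \<in> X \<rightarrow> X"
    and contr: "\<And>x y. x \<in> X \<Longrightarrow> y \<in> X \<Longrightarrow>
           \<Delta> (T x) (T y) \<le> \<theta> (Max {\<Delta> x y, \<Delta> x (T x), \<Delta> y (T y)})"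
begin

lemma sm: "semi_metric X \<Delta>"
  using bsm by (simp add: b_suprametric_def)

lemma orbit_tail_diameter_le:
  assumes "x \<in> X" and M: "\<And>m n. \<Delta> ((T ^^ m) x) ((T ^^ n) x) \<le> M"
    and "k \<le> m" and "k \<le> n"
  shows "\<Delta> ((T ^^ m) x) ((T ^^ n) x) \<le> (\<theta> ^^ k) M"
  using \<open>k \<le> m\<close> \<open>k \<le> n\<close>
proof (induction k arbitrary: m n)
  case 0
  show ?case using M by simp
next
  case (Suc k)
  have orb: "(T ^^ i) x \<in> X" for i
    using T \<open>x \<in> X\<close> by (induction i) auto
  obtain m' n' where mn: "m = Suc m'" "n = Suc n'" "k \<le> m'" "k \<le> n'"
    using Suc.prems Suc_le_D[of k m] Suc_le_D[of k n] by auto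
  let ?S = "Max {\<Delta> ((T ^^ m') x) ((T ^^ n') x), \<Delta> ((T ^^ m') x) ((T ^^ Suc m') x),
    \<Delta> ((T ^^ n') x) ((T ^^ Suc n') x)}"
  \<comment> \<open>All three entries compare orbit points with indices at least \<open>k\<close>,
    so the induction hypothesis covers each; this is why \<open>m\<close> and \<open>n\<close> are
    kept arbitrary.\<close>
  have "?S \<le> (\<theta> ^^ k) M"
    using Suc.IH[of m' n'] Suc.IH[of m' "Suc m'"] Suc.IH[of n' "Suc n'"] mn by simp
  \<comment> \<open>\<open>\<theta>\<close> is monotone only on \<open>{0..}\<close>, so both
    arguments must be placed there; the larger one follows from the smaller.\<close>
  moreover have "0 \<le> ?S"
    using sm orb[of m'] orb[of n'] by (auto simp: semi_metric_def le_max_iff_disj)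
  ultimately have "\<theta> ?S \<le> \<theta> ((\<theta> ^^ k) M)"
    using Theta1 by (auto simp: Theta1_def intro!: mono_onD[of "{0..}" \<theta>])
  moreover have "\<Delta> ((T ^^ m) x) ((T ^^ n) x) \<le> \<theta> ?S"
    using contr[OF orb[of m'] orb[of n']] mn by simp
  ultimately show ?case by simp
qed

lemma orbit_Cauchy:
  assumes "x \<in> X" and "sm_bounded X \<Delta> (range (\<lambda>n. (T ^^ n) x))"
  shows "sm_Cauchy X \<Delta> (\<lambda>n. (T ^^ n) x)"
  unfolding sm_Cauchy_def
proof (intro conjI allI impI)
  show "range (\<lambda>n. (T ^^ n) x) \<subseteq> X"
    using assms(2) by (simp add: sm_bounded_def)
  fix \<epsilon> :: real
  assume "0 < \<epsilon>"
  obtain M where "0 < M" and M: "\<And>m n. \<Delta> ((T ^^ m) x) ((T ^^ n) x) \<le> M"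
    using assms(2) by (auto simp: sm_bounded_def)
  from \<open>0 < M\<close> Theta1 have "(\<lambda>n. (\<theta> ^^ n) M) \<longlonglongrightarrow> 0"
    by (simp add: Theta1_def)
  then have "eventually (\<lambda>n. (\<theta> ^^ n) M < \<epsilon>) sequentially"
    using \<open>0 < \<epsilon>\<close> by (rule order_tendstoD(2))
  \<comment> \<open>This one \<open>k\<close> can serve as \<open>m0\<close>, because the diameter
    bound is uniform over all indices from \<open>k\<close> on.\<close>
  then obtain k where "(\<theta> ^^ k) M < \<epsilon>"
    unfolding eventually_sequentially by blast
  then show "\<exists>m0. \<forall>n>m0. \<forall>m>m0. \<Delta> ((T ^^ n) x) ((T ^^ m) x) < \<epsilon>"
    using orbit_tail_diameter_le[OF \<open>x \<in> X\<close> M, of k]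
    by (meson le_less_trans less_imp_le)
qed

lemma orbit_limit_fixed_point:
  assumes cont: "sm_continuous_map X \<Delta> T \<or> separately_continuous X \<Delta>"
    and cauchy: "sm_Cauchy X \<Delta> (\<lambda>n. (T ^^ n) x)"
    and conv: "sm_converges X \<Delta> (\<lambda>n. (T ^^ n) x) \<xi>"
  shows "T \<xi> = \<xi>"
proof -
  let ?u = "\<lambda>n. (T ^^ n) x"
  have X: "\<xi> \<in> X" "T \<xi> \<in> X" "\<And>n. ?u n \<in> X" and lim: "(\<lambda>n. \<Delta> (?u n) \<xi>) \<longlonglongrightarrow> 0"
    using conv T by (auto simp: sm_converges_def)
  have conv_Suc: "sm_converges X \<Delta> (\<lambda>n. ?u (Suc n)) \<xi>"
    using conv LIMSEQ_Suc[OF lim] unfolding sm_converges_def by blast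
  from cont show ?thesis
  proof
    assume "sm_continuous_map X \<Delta> T"
    with conv have "sm_converges X \<Delta> (\<lambda>n. T (?u n)) (T \<xi>)"
      by (auto simp: sm_continuous_map_def)
    \<comment> \<open>The image of the orbit is its own shift, which also tends to
      \<open>\<xi>\<close>.\<close>
    then have "sm_converges X \<Delta> (\<lambda>n. ?u (Suc n)) (T \<xi>)"
      by simp
    from b_suprametric_limit_unique[OF bsm this conv_Suc] show ?thesis .
  next
    assume sep: "separately_continuous X \<Delta>"
    define d where "d = \<Delta> \<xi> (T \<xi>)"
    have "0 \<le> d" and d0: "d = 0 \<longleftrightarrow> \<xi> = T \<xi>" and sym: "\<Delta> (T \<xi>) \<xi> = d"
      using sm X(1,2) unfolding semi_metric_def d_def by blast+
    have "d = 0"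
    proof (rule ccontr)
      assume "d \<noteq> 0"
      with \<open>0 \<le> d\<close> have "0 < d" by simp
      obtain m0 where m0: "\<And>m n. n > m0 \<Longrightarrow> m > m0 \<Longrightarrow> \<Delta> (?u n) (?u m) < d"
        using cauchy[unfolded sm_Cauchy_def, THEN conjunct2, rule_format, OF \<open>0 < d\<close>] by auto
      obtain m1 where m1: "\<And>n. n \<ge> m1 \<Longrightarrow> \<Delta> (?u n) \<xi> < d"
        using order_tendstoD(2)[OF lim \<open>0 < d\<close>] unfolding eventually_sequentially by auto
      \<comment> \<open>Far along the orbit, the distance to \<open>\<xi>\<close> and the step
        length both drop below \<open>d\<close>, so the maximum equals \<open>d\<close> exactly. The
        bound is then constant in \<open>n\<close> and survives the limit. \<open>Suc m0\<close>
        accounts for the strict inequality in the Cauchy condition.\<close>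
      have "\<Delta> (T \<xi>) (?u (Suc n)) \<le> \<theta> d" if "n \<ge> max (Suc m0) m1" for n
      proof -
        have "\<Delta> (?u n) \<xi> < d" "\<Delta> (?u n) (T (?u n)) < d"
          using m1[of n] m0[of n "Suc n"] that by auto
        then have "Max {\<Delta> (?u n) \<xi>, \<Delta> (?u n) (T (?u n)), \<Delta> \<xi> (T \<xi>)} = d"
          by (auto simp: d_def)
        then have "\<Delta> (T (?u n)) (T \<xi>) \<le> \<theta> d"
          using contr[OF X(3)[of n] X(1)] by simp
        \<comment> \<open>Separate continuity is phrased for the second argument, so the orbit point
          is moved there.\<close>
        moreover have "\<Delta> (T \<xi>) (?u (Suc n)) = \<Delta> (?u (Suc n)) (T \<xi>)"
          using sm X(2) X(3)[of "Suc n"] unfolding semi_metric_def by blast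
        ultimately show ?thesis by simp
      qed
      moreover have "(\<lambda>n. \<Delta> (T \<xi>) (?u (Suc n))) \<longlonglongrightarrow> d"
        using sep conv_Suc X(2) sym unfolding separately_continuous_def by metis
      ultimately have "d \<le> \<theta> d"
        by (blast intro: LIMSEQ_le_const2)
      with Theta1_no_subfixed_point[OF Theta1 \<open>0 \<le> d\<close>] \<open>d \<noteq> 0\<close> show False by simp
    qed
    with d0 show ?thesis by simp
  qed
qed

text \<open>At fixed points the two displacement entries of the maximum vanish, leaving
  \<open>\<Delta> \<xi> \<eta> \<le> \<theta> (\<Delta> \<xi> \<eta>)\<close>.\<close>

lemma fixed_point_unique:
  assumes "\<xi> \<in> X" "\<eta> \<in> X" "T \<xi> = \<xi>" "T \<eta> = \<eta>"
  shows "\<xi> = \<eta>"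
proof -
  have "\<Delta> \<xi> \<xi> = 0" "\<Delta> \<eta> \<eta> = 0" "0 \<le> \<Delta> \<xi> \<eta>" "\<Delta> \<xi> \<eta> = 0 \<longleftrightarrow> \<xi> = \<eta>"
    using sm assms by (auto simp: semi_metric_def)
  moreover from this have "\<Delta> \<xi> \<eta> \<le> \<theta> (\<Delta> \<xi> \<eta>)"
    using contr[OF assms(1,2)] assms(3,4) by simp
  ultimately show ?thesis
    using Theta1_no_subfixed_point[OF Theta1] by blast
qed

end

theorem theorem3:
  fixes X :: "'a set" and \<Delta> :: "'a \<Rightarrow> 'a \<Rightarrow> real"
    and \<theta> :: "real \<Rightarrow> real" and T :: "'a \<Rightarrow> 'a"
  assumes "X \<noteq> {}"
    and "b_suprametric X \<Delta>"
    and "sm_complete X \<Delta>"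
    and "\<theta> \<in> Theta1"
    and "T \<in> X \<rightarrow> X"
    and "\<And>x y. x \<in> X \<Longrightarrow> y \<in> X \<Longrightarrow>
           \<Delta> (T x) (T y) \<le> \<theta> (Max {\<Delta> x y, \<Delta> x (T x), \<Delta> y (T y)})"
    and "sm_continuous_map X \<Delta> T \<or> separately_continuous X \<Delta>"
    and "bounded_orbits X \<Delta> T"
  shows "\<exists>\<xi>\<in>X. (\<forall>x\<in>X. sm_converges X \<Delta> (\<lambda>n. (T ^^ Suc n) x) \<xi>) \<and>
           T \<xi> = \<xi> \<and> (\<forall>\<eta>\<in>X. T \<eta> = \<eta> \<longrightarrow> \<eta> = \<xi>)"
proof -
  interpret b_suprametric_contraction X \<Delta> \<theta> T
    by (rule b_suprametric_contraction.intro) (fact assms)+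
  \<comment> \<open>Here the limit may still depend on \<open>x\<close>; uniqueness of the fixed
    point later merges all these limits into one.\<close>
  have lim: "\<exists>\<xi>\<in>X. sm_converges X \<Delta> (\<lambda>n. (T ^^ n) x) \<xi> \<and> T \<xi> = \<xi>" if "x \<in> X" for x
  proof -
    have "sm_bounded X \<Delta> (range (\<lambda>n. (T ^^ n) x))"
      using assms(8) that by (simp add: bounded_orbits_def)
    then have cauchy: "sm_Cauchy X \<Delta> (\<lambda>n. (T ^^ n) x)"
      by (rule orbit_Cauchy[OF that])
    then obtain \<xi> where "\<xi> \<in> X" "sm_converges X \<Delta> (\<lambda>n. (T ^^ n) x) \<xi>"
      using assms(3) by (auto simp: sm_complete_def)
    then show ?thesis
      using orbit_limit_fixed_point[OF assms(7) cauchy] by blast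
  qed
  obtain \<xi> where \<xi>: "\<xi> \<in> X" "T \<xi> = \<xi>"
    using assms(1) lim by blast
  have unique: "\<eta> = \<xi>" if "\<eta> \<in> X" "T \<eta> = \<eta>" for \<eta>
    by (rule fixed_point_unique[OF that(1) \<xi>(1) that(2) \<xi>(2)])
  \<comment> \<open>The sequence in the claim starts at the first iterate, so convergence of the
    full orbit is shifted by one index.\<close>
  have "sm_converges X \<Delta> (\<lambda>n. (T ^^ Suc n) x) \<xi>" if x: "x \<in> X" for x
  proof -
    have conv: "sm_converges X \<Delta> (\<lambda>n. (T ^^ n) x) \<xi>"
      using lim[OF x] unique by blast
    then have "(\<lambda>n. \<Delta> ((T ^^ Suc n) x) \<xi>) \<longlonglongrightarrow> 0"
      unfolding sm_converges_def by (intro LIMSEQ_Suc) simp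
    with conv show ?thesis
      unfolding sm_converges_def by blast
  qed
  with \<xi> unique show ?thesis by blast
qed

end
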